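(* There exists $L_0>0$ such that for every $L\ge L_0$ the constant function $z_L=L^{-1/2}$ on $\mathbb{T}_L$ is not a maximizer of the problem $$\omega_1(L)=\max_{\|f\|_{L^2(\mathbb{T}_L)}=1}\mathcal{Q}(f,f,f,f).$$
   Context: For $L>0$, $\mathbb{T}_L=\mathbb{R}/(L\mathbb{Z})$, with $\|f\|_{L^2(\mathbb{T}_L)}^2=\int_0^L|f(x)|^2\,dx$ (so $\|z_L\|_{L^2(\mathbb{T}_L)}=1$). $T_r=e^{ir\partial_x^2}$ is the free Schrödinger propagator on $\mathbb{T}_L$, and $$\mathcal{Q}(f_1,f_2,f_3,f_4)=\int_0^1\int_{\mathbb{T}_L}\overline{T_rf_1}\,T_rf_2\,\overline{T_rf_3}\,T_rf_4\,dx\,dr .$$ *)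

theory Defs
  imports "HOL-Analysis.Analysis"
begin

text \<open>
  A function on the torus \<open>\<real> / L\<int>\<close> is represented by an \<open>L\<close>-periodic function on \<open>\<real>\<close>,
  and integration over the torus is Lebesgue integration over one period.
  Elements of \<open>L2_torus L\<close> are functions rather than equivalence classes;
  everything below except the choice of representative in \<open>schroedinger\<close> depends
  only on the classes modulo null sets.
\<close>

definition L2_torus :: "real \<Rightarrow> (real \<Rightarrow> complex) set" where
  "L2_torus L = {f. (\<forall>x. f (x + L) = f x) \<and> f \<in> borel_measurable lebesgue \<and>
     set_integrable lebesgue {0..L} (\<lambda>x. (cmod (f x))\<^sup>2)}"

definition L2_norm_torus :: "real \<Rightarrow> (real \<Rightarrow> complex) \<Rightarrow> real" where
  "L2_norm_torus L f = sqrt (LINT x:{0..L}|lebesgue. (cmod (f x))\<^sup>2)"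

definition fourier_mode :: "real \<Rightarrow> int \<Rightarrow> real \<Rightarrow> complex" where
  "fourier_mode L k x = cis (2 * pi * of_int k * x / L)"

definition fourier_coeff :: "real \<Rightarrow> (real \<Rightarrow> complex) \<Rightarrow> int \<Rightarrow> complex" where
  "fourier_coeff L f k =
     (LINT x:{0..L}|lebesgue. f x * cnj (fourier_mode L k x)) / of_real L"

text \<open>
  The propagator \<open>exp (i r \<partial>\<^sub>x\<^sup>2)\<close> multiplies the \<open>k\<close>-th Fourier mode, an eigenfunction
  of \<open>\<partial>\<^sub>x\<^sup>2\<close> with eigenvalue \<open>- (2 \<pi> k / L)\<^sup>2\<close>, by \<open>exp (- i r (2 \<pi> k / L)\<^sup>2)\<close>.
  For \<open>f\<close> in \<open>L\<^sup>2\<close> the resulting Fourier series converges in \<open>L\<^sup>2\<close>, so its limit is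
  determined up to a null set, and \<open>schroedinger L r f\<close> is some representative of it.
\<close>

definition schroedinger_partial_sum ::
  "real \<Rightarrow> real \<Rightarrow> (real \<Rightarrow> complex) \<Rightarrow> nat \<Rightarrow> real \<Rightarrow> complex" where
  "schroedinger_partial_sum L r f N x =
     (\<Sum>k\<in>{- int N..int N}.
        cis (- r * (2 * pi * of_int k / L)\<^sup>2) * fourier_coeff L f k * fourier_mode L k x)"

definition schroedinger :: "real \<Rightarrow> real \<Rightarrow> (real \<Rightarrow> complex) \<Rightarrow> real \<Rightarrow> complex" where
  "schroedinger L r f = (SOME g. g \<in> L2_torus L \<and>
     (\<lambda>N. L2_norm_torus L (\<lambda>x. schroedinger_partial_sum L r f N x - g x)) \<longlonglongrightarrow> 0)"

definition strichartz_form ::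
  "real \<Rightarrow> (real \<Rightarrow> complex) \<Rightarrow> (real \<Rightarrow> complex) \<Rightarrow> (real \<Rightarrow> complex) \<Rightarrow> (real \<Rightarrow> complex) \<Rightarrow> complex"
  where
  "strichartz_form L f1 f2 f3 f4 =
     (LINT r:{0..1}|lebesgue. (LINT x:{0..L}|lebesgue.
        cnj (schroedinger L r f1 x) * schroedinger L r f2 x *
        cnj (schroedinger L r f3 x) * schroedinger L r f4 x))"

text \<open>
  On the diagonal the form is the integral of \<open>|T\<^sub>r f|\<^sup>4\<close>, which is real (and finite for
  \<open>f\<close> in \<open>L\<^sup>2\<close>, by the periodic Strichartz estimate); the real part below only
  changes the type.
\<close>

definition is_omega1_maximizer :: "real \<Rightarrow> (real \<Rightarrow> complex) \<Rightarrow> bool" where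
  "is_omega1_maximizer L =
     is_arg_max (\<lambda>f. Re (strichartz_form L f f f f))
       (\<lambda>f. f \<in> L2_torus L \<and> L2_norm_torus L f = 1)"

definition z_const :: "real \<Rightarrow> real \<Rightarrow> complex" where
  "z_const L = (\<lambda>x. of_real (L powr (- 1 / 2)))"

end

theory Submission
  imports Defs
begin

text \<open>
  The cosine \<open>sqrt (2 / L) cos (2 \<pi> x / L)\<close> has unit norm and is an eigenfunction of
  \<open>\<partial>\<^sub>x\<^sup>2\<close>, so \<open>|T\<^sub>r f| = |f|\<close> and the form at \<open>f\<close> is \<open>\<integral> |f|\<^sup>4 = 3 / (2 L)\<close>. The constant
  function only reaches \<open>1 / L\<close>. Hence any \<open>L\<^sub>0 > 0\<close> works.
\<close>

section \<open>Fourier modes and their integrals over a period\<close>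

lemma fourier_mode_add_period:
  assumes "L > 0"
  shows "fourier_mode L k (x + L) = fourier_mode L k x"
proof -
  have "2 * pi * of_int k * (x + L) / L = 2 * pi * of_int k * x / L + 2 * pi * of_int k"
    using assms by (simp add: field_simps)
  then show ?thesis
    by (simp add: fourier_mode_def flip: cis_mult)
qed

lemma fourier_mode_mult: "fourier_mode L j x * fourier_mode L k x = fourier_mode L (j + k) x"
  by (simp add: fourier_mode_def cis_mult ring_distribs add_divide_distrib)

lemma cnj_fourier_mode: "cnj (fourier_mode L k x) = fourier_mode L (- k) x"
  by (simp add: fourier_mode_def cis_cnj)

lemma fourier_mode_0 [simp]: "fourier_mode L 0 x = 1"
  by (simp add: fourier_mode_def)

lemma continuous_on_fourier_mode [continuous_intros]: "continuous_on S (fourier_mode L k)"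
  \<comment> \<open>Division by zero yields 0, so for \<open>L = 0\<close> the mode is the constant
    1.\<close>
  unfolding fourier_mode_def by (cases "L = 0") (auto intro!: continuous_intros)

lemma integrable_on_period:
  fixes f :: "real \<Rightarrow> 'a::euclidean_space"
  assumes "continuous_on UNIV f"
  shows "set_integrable lebesgue {0..L} f"
  using assms by (intro absolutely_integrable_continuous_real) (auto intro: continuous_on_subset)

text \<open>For \<open>k \<noteq> 0\<close> the mode has an antiderivative that is a multiple of the
  mode itself, hence periodic, so its increment over one period vanishes.\<close>

lemma LINT_fourier_mode:
  assumes "L > 0"
  shows "(LINT x:{0..L}|lebesgue. fourier_mode L k x) = (if k = 0 then of_real L else 0)"
proof -
  \<comment> \<open>The value is computed as a gauge integral, where the fundamental theorem of
    calculus applies; continuity then transfers it to the Lebesgue integral.\<close>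
  have "(fourier_mode L k has_integral (if k = 0 then of_real L else 0)) {0..L}"
  proof (cases "k = 0")
    case True
    then show ?thesis
      using has_integral_const_real[of "1::complex" 0 L] assms
      by (simp add: fourier_mode_def[abs_def] scaleR_conv_of_real)
  next
    case False
    define c where "c = 2 * pi * of_int k / L"
    have c: "c \<noteq> 0" using False assms by (simp add: c_def)
    have eq: "fourier_mode L k = (\<lambda>x. exp (\<i> * of_real c * of_real x))"
      by (auto simp: fourier_mode_def c_def cis_conv_exp mult_ac)
    define F where "F = (\<lambda>x::real. exp (\<i> * of_real c * of_real x) / (\<i> * of_real c))"
    have "(fourier_mode L k has_integral (F L - F 0)) {0..L}"
      unfolding eq F_def
      by (rule fundamental_theorem_of_calculus)
        (use assms c in \<open>auto intro!: derivative_eq_intros has_vector_derivative_real_field\<close>)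
    moreover have "F L = F 0"
      using fourier_mode_add_period[OF assms, of k 0] by (simp add: F_def eq)
    ultimately show ?thesis using False by simp
  qed
  then show ?thesis
    by (simp add: set_lebesgue_integral_eq_integral[OF integrable_on_period]
        continuous_on_fourier_mode integral_unique)
qed

text \<open>Only the terms of frequency zero survive integration. The frequency is a function
  \<open>p\<close> of the index so that the lemma covers both the shifts \<open>k - j\<close> in
  Fourier coefficients and the frequencies \<open>2 * (k - n)\<close> in a binomial
  expansion.\<close>

lemma LINT_trig_poly:
  assumes "L > 0" "finite A"
  shows "(LINT x:{0..L}|lebesgue. \<Sum>k\<in>A. a k * fourier_mode L (p k) x)
    = of_real L * (\<Sum>k\<in>A. if p k = 0 then a k else 0)"
proof -
  have "(LINT x:{0..L}|lebesgue. \<Sum>k\<in>A. a k * fourier_mode L (p k) x)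
      = (\<Sum>k\<in>A. LINT x:{0..L}|lebesgue. a k * fourier_mode L (p k) x)"
    unfolding set_lebesgue_integral_def scaleR_sum_right
    by (intro Bochner_Integration.integral_sum integrable_on_period[unfolded set_integrable_def])
      (auto intro!: continuous_intros)
  also have "\<dots> = (\<Sum>k\<in>A. a k * (if p k = 0 then of_real L else 0))"
    by (simp add: LINT_fourier_mode assms)
  also have "\<dots> = of_real L * (\<Sum>k\<in>A. if p k = 0 then a k else 0)"
    by (auto simp: sum_distrib_left intro!: sum.cong)
  finally show ?thesis .
qed

lemma fourier_coeff_trig_poly:
  assumes "L > 0" "finite A"
  shows "fourier_coeff L (\<lambda>x. \<Sum>k\<in>A. a k * fourier_mode L k x) j = (if j \<in> A then a j else 0)"
proof -
  have "(\<Sum>k\<in>A. a k * fourier_mode L k x) * cnj (fourier_mode L j x)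
      = (\<Sum>k\<in>A. a k * fourier_mode L (k - j) x)" for x
    by (simp add: sum_distrib_right mult.assoc cnj_fourier_mode fourier_mode_mult)
  moreover have "(\<Sum>k\<in>A. if k = j then a k else 0) = (if j \<in> A then a j else 0)"
    using assms by simp
  ultimately show ?thesis
    using assms by (simp add: fourier_coeff_def LINT_trig_poly del: sum.delta)
qed

section \<open>Trigonometric polynomials under the propagator\<close>

lemma trig_poly_in_L2_torus:
  assumes "L > 0"
  shows "(\<lambda>x. \<Sum>k\<in>A. a k * fourier_mode L k x) \<in> L2_torus L"
proof -
  have "continuous_on UNIV (\<lambda>x. \<Sum>k\<in>A. a k * fourier_mode L k x)"
    by (intro continuous_intros)
  then have "(\<lambda>x. \<Sum>k\<in>A. a k * fourier_mode L k x) \<in> borel_measurable lebesgue"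
    by (simp add: measurable_completion borel_measurable_continuous_onI)
  moreover have "set_integrable lebesgue {0..L} (\<lambda>x. (cmod (\<Sum>k\<in>A. a k * fourier_mode L k x))\<^sup>2)"
    by (intro integrable_on_period continuous_intros)
  ultimately show ?thesis
    by (simp add: L2_torus_def fourier_mode_add_period assms)
qed

text \<open>This is the uniqueness of limits in L2: it identifies the representative chosen by
  \<open>SOME\<close> in \<open>schroedinger\<close> with an explicit function, up to a null
  set.\<close>

lemma AE_eq_if_L2_norm_torus_diff_eq_0:
  assumes "f \<in> L2_torus L" "g \<in> L2_torus L" and 0: "L2_norm_torus L (\<lambda>x. f x - g x) = 0"
  shows "AE x in lebesgue. x \<in> {0..L} \<longrightarrow> f x = g x"
proof -
  have [measurable]: "f \<in> borel_measurable lebesgue" "g \<in> borel_measurable lebesgue"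
    using assms by (auto simp: L2_torus_def)
  have bound: "(cmod (u - v))\<^sup>2 \<le> 2 * (cmod u)\<^sup>2 + 2 * (cmod v)\<^sup>2" for u v
  proof -
    have "(cmod (u - v))\<^sup>2 \<le> (cmod u + cmod v)\<^sup>2"
      by (intro power_mono norm_triangle_ineq4) auto
    also have "\<dots> \<le> 2 * (cmod u)\<^sup>2 + 2 * (cmod v)\<^sup>2"
      using zero_le_power2[of "cmod u - cmod v"] by (simp add: power2_eq_square algebra_simps)
    finally show ?thesis .
  qed
  \<comment> \<open>Integrability has to be established first: a non-integrable function has
    Lebesgue integral 0 by convention, so a zero integral alone would say nothing about the
    integrand.\<close>
  have "set_integrable lebesgue {0..L} (\<lambda>x. 2 * (cmod (f x))\<^sup>2 + 2 * (cmod (g x))\<^sup>2)"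
    using assms by (intro set_integral_add set_integrable_mult_right) (auto simp: L2_torus_def)
  then have int: "set_integrable lebesgue {0..L} (\<lambda>x. (cmod (f x - g x))\<^sup>2)"
  proof (rule set_integrable_bound)
    show "set_borel_measurable lebesgue {0..L} (\<lambda>x. (cmod (f x - g x))\<^sup>2)"
      unfolding set_borel_measurable_def
      by (intro borel_measurable_scaleR borel_measurable_indicator borel_measurable_power
          borel_measurable_norm borel_measurable_diff) auto
  qed (auto simp: bound)
  have "(LINT x:{0..L}|lebesgue. (cmod (f x - g x))\<^sup>2) = 0"
    using 0 by (simp add: L2_norm_torus_def)
  then have "AE x in lebesgue. indicat_real {0..L} x *\<^sub>R (cmod (f x - g x))\<^sup>2 = 0"
    using int unfolding set_lebesgue_integral_def set_integrable_def
    by (subst (asm) integral_nonneg_eq_0_iff_AE) auto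
  then show ?thesis
    by eventually_elim auto
qed

text \<open>Once the summation range contains \<open>A\<close>, the partial sums all equal the
  polynomial with rotated coefficients. That polynomial is therefore an L2 limit, and any other
  limit agrees with it almost everywhere on the period.\<close>

lemma schroedinger_trig_poly:
  assumes L: "L > 0" and A: "finite A"
  defines "f \<equiv> \<lambda>a x. \<Sum>k\<in>A. a k * fourier_mode L k x"
  shows "schroedinger L r (f a) \<in> L2_torus L" (is ?in_L2)
    and "AE x in lebesgue. x \<in> {0..L} \<longrightarrow>
      schroedinger L r (f a) x = f (\<lambda>k. cis (- r * (2 * pi * of_int k / L)\<^sup>2) * a k) x" (is ?AE)
proof -
  define h where "h = f (\<lambda>k. cis (- r * (2 * pi * of_int k / L)\<^sup>2) * a k)"
  have h: "h \<in> L2_torus L"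
    unfolding h_def f_def by (rule trig_poly_in_L2_torus[OF L])
  obtain M where M: "A \<subseteq> {- int M..int M}"
  proof
    \<comment> \<open>The sum of all \<open>\<bar>k\<bar>\<close> is a crude bound on the
      frequencies that also makes sense for empty \<open>A\<close>.\<close>
    show "A \<subseteq> {- int (nat (\<Sum>k\<in>A. \<bar>k\<bar>))..int (nat (\<Sum>k\<in>A. \<bar>k\<bar>))}"
    proof
      fix j assume "j \<in> A"
      then have "\<bar>j\<bar> \<le> (\<Sum>k\<in>A. \<bar>k\<bar>)"
        using A by (intro member_le_sum) auto
      then show "j \<in> {- int (nat (\<Sum>k\<in>A. \<bar>k\<bar>))..int (nat (\<Sum>k\<in>A. \<bar>k\<bar>))}"
        by auto
    qed
  qed
  have partial: "schroedinger_partial_sum L r (f a) N = h" if "N \<ge> M" for N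
  proof
    fix x
    have "A \<subseteq> {- int N..int N}" using M that by force
    then show "schroedinger_partial_sum L r (f a) N x = h x"
      unfolding schroedinger_partial_sum_def h_def f_def fourier_coeff_trig_poly[OF L A]
      by (intro sum.mono_neutral_cong_right) auto
  qed
  \<comment> \<open>Here \<open>g\<close> is arbitrary because the limit is used twice: with
    \<open>h\<close>, to show that the choice has a witness, and with the chosen representative, to
    compare it with \<open>h\<close>.\<close>
  have lim: "(\<lambda>N. L2_norm_torus L (\<lambda>x. schroedinger_partial_sum L r (f a) N x - g x))
      \<longlonglongrightarrow> L2_norm_torus L (\<lambda>x. h x - g x)" for g
    by (rule tendsto_eventually) (auto simp: eventually_sequentially partial intro!: exI[of _ M])
  let ?P = "\<lambda>g. g \<in> L2_torus L \<and>
     (\<lambda>N. L2_norm_torus L (\<lambda>x. schroedinger_partial_sum L r (f a) N x - g x)) \<longlonglongrightarrow> 0"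
  have "?P h"
    using h lim[of h] by (simp add: L2_norm_torus_def)
  then have S: "?P (schroedinger L r (f a))"
    unfolding schroedinger_def by (rule someI[of ?P])
  then show ?in_L2 ..
  have "L2_norm_torus L (\<lambda>x. h x - schroedinger L r (f a) x) = 0"
    using S lim LIMSEQ_unique by blast
  then have "AE x in lebesgue. x \<in> {0..L} \<longrightarrow> h x = schroedinger L r (f a) x"
    using S h by (intro AE_eq_if_L2_norm_torus_diff_eq_0) auto
  then show ?AE
    unfolding h_def by eventually_elim auto
qed

section \<open>The form on eigenfunctions\<close>

text \<open>Frequencies with \<open>k\<^sup>2 = m\<close> share one eigenvalue, so the propagator
  multiplies \<open>f\<close> by a single unimodular phase, which cancels in the fourfold product.
  The inner integral is then independent of \<open>r\<close>, and the time interval has length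
  1.\<close>

lemma strichartz_form_eigenfunction:
  fixes a :: "int \<Rightarrow> complex"
  assumes L: "L > 0" and A: "finite A" "\<And>k. k \<in> A \<Longrightarrow> k\<^sup>2 = m"
  defines "f \<equiv> \<lambda>x. \<Sum>k\<in>A. a k * fourier_mode L k x"
  shows "strichartz_form L f f f f = (LINT x:{0..L}|lebesgue. complex_of_real (cmod (f x) ^ 4))"
proof -
  have [measurable]: "f \<in> borel_measurable lebesgue"
    using trig_poly_in_L2_torus[OF L] by (auto simp: f_def L2_torus_def)
  have inner: "(LINT x:{0..L}|lebesgue. cnj (schroedinger L r f x) * schroedinger L r f x *
      cnj (schroedinger L r f x) * schroedinger L r f x)
    = (LINT x:{0..L}|lebesgue. complex_of_real (cmod (f x) ^ 4))" for r
  proof (rule set_lebesgue_integral_cong_AE)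
    have "schroedinger L r f \<in> L2_torus L"
      unfolding f_def by (rule schroedinger_trig_poly[OF L A(1)])
    then have [measurable]: "schroedinger L r f \<in> borel_measurable lebesgue"
      by (simp add: L2_torus_def)
    have [measurable]: "cnj \<in> borel_measurable borel"
      by (intro borel_measurable_continuous_onI continuous_intros)
    show "(\<lambda>x. cnj (schroedinger L r f x) * schroedinger L r f x *
      cnj (schroedinger L r f x) * schroedinger L r f x) \<in> borel_measurable lebesgue"
      by measurable
    have eigen: "(\<Sum>k\<in>A. cis (- r * (2 * pi * of_int k / L)\<^sup>2) * a k * fourier_mode L k x)
        = cis (- r * (2 * pi / L)\<^sup>2 * of_int m) * f x" for x
      unfolding f_def sum_distrib_left
    proof (intro sum.cong refl)
      fix k assume "k \<in> A"
      then have phase: "(2 * pi * of_int k / L)\<^sup>2 = (2 * pi / L)\<^sup>2 * of_int m"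
        by (simp add: power_mult_distrib power_divide flip: A(2))
      show "cis (- r * (2 * pi * of_int k / L)\<^sup>2) * a k * fourier_mode L k x
          = cis (- r * (2 * pi / L)\<^sup>2 * of_int m) * (a k * fourier_mode L k x)"
        unfolding phase by (simp add: mult.assoc)
    qed
    have pow4: "cnj w * w * cnj w * w = complex_of_real (cmod w ^ 4)" for w
    proof -
      have "cnj w * w * cnj w * w = (w * cnj w) ^ 2"
        by (simp add: power2_eq_square mult_ac)
      also have "\<dots> = complex_of_real (cmod w ^ 4)"
        by (simp add: complex_norm_square[symmetric] flip: power_mult)
      finally show ?thesis .
    qed
    have "AE x in lebesgue. x \<in> {0..L} \<longrightarrow>
        schroedinger L r f x = cis (- r * (2 * pi / L)\<^sup>2 * of_int m) * f x"
      using schroedinger_trig_poly(2)[OF L A(1), of r a]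
      unfolding eigen f_def[symmetric] .
    then show "AE x \<in> {0..L} in lebesgue. cnj (schroedinger L r f x) * schroedinger L r f x *
        cnj (schroedinger L r f x) * schroedinger L r f x = complex_of_real (cmod (f x) ^ 4)"
      unfolding pow4 by eventually_elim (simp add: norm_mult)
  qed auto
  show ?thesis
    unfolding strichartz_form_def inner by (simp add: set_lebesgue_integral_def)
qed

section \<open>Even moments of the cosine\<close>

lemma fourier_mode_power: "fourier_mode L k x ^ n = fourier_mode L (int n * k) x"
  by (induction n) (simp_all add: fourier_mode_mult ring_distribs)

text \<open>In the binomial expansion the \<open>k\<close>-th term has frequency
  \<open>2 * (k - n)\<close>, so only the central term \<open>k = n\<close> contributes to the
  integral.\<close>

lemma LINT_cosine_power:
  assumes "L > 0"
  shows "(LINT x:{0..L}|lebesgue. (c * fourier_mode L 1 x + c * fourier_mode L (- 1) x) ^ (2 * n))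
    = of_real L * c ^ (2 * n) * of_nat ((2 * n) choose n)"
proof -
  have "(c * fourier_mode L 1 x + c * fourier_mode L (- 1) x) ^ (2 * n)
      = (\<Sum>k\<le>2 * n. c ^ (2 * n) * of_nat ((2 * n) choose k) * fourier_mode L (2 * (int k - int n)) x)"
    for x
  proof -
    have "(c * fourier_mode L 1 x + c * fourier_mode L (- 1) x) ^ (2 * n)
        = c ^ (2 * n) * (fourier_mode L 1 x + fourier_mode L (- 1) x) ^ (2 * n)"
      by (simp flip: distrib_left power_mult_distrib)
    also have "\<dots> = (\<Sum>k\<le>2 * n. c ^ (2 * n) * of_nat ((2 * n) choose k) *
        (fourier_mode L 1 x ^ k * fourier_mode L (- 1) x ^ (2 * n - k)))"
      by (simp only: binomial_ring sum_distrib_left mult.assoc)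
    also have "\<dots> = (\<Sum>k\<le>2 * n. c ^ (2 * n) * of_nat ((2 * n) choose k) *
        fourier_mode L (2 * (int k - int n)) x)"
    proof (intro sum.cong refl)
      fix k assume "k \<in> {..2 * n}"
      then have "int k * 1 + int (2 * n - k) * - 1 = 2 * (int k - int n)"
        by (simp add: of_nat_diff)
      then show "c ^ (2 * n) * of_nat ((2 * n) choose k) *
          (fourier_mode L 1 x ^ k * fourier_mode L (- 1) x ^ (2 * n - k))
        = c ^ (2 * n) * of_nat ((2 * n) choose k) * fourier_mode L (2 * (int k - int n)) x"
        by (simp only: fourier_mode_power fourier_mode_mult)
    qed
    finally show ?thesis .
  qed
  then show ?thesis
    by (simp add: LINT_trig_poly[OF assms])
qed

section \<open>Comparison of the cosine with the constant\<close>

theorem theorem1p4: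
  "\<exists>L0::real. L0 > 0 \<and> (\<forall>L\<ge>L0. \<not> is_omega1_maximizer L (z_const L))"
proof (intro exI[of _ 1] conjI allI impI)
  fix L :: real assume "L \<ge> 1"
  then have L: "L > 0" by simp
  \<comment> \<open>This is half the amplitude \<open>sqrt (2 / L)\<close>, as the cosine is the
    mean of two modes; it makes the squared norm \<open>2 * L * c\<^sup>2\<close> equal to
    1.\<close>
  define c where "c = sqrt (1 / (2 * L))"
  have c2: "c\<^sup>2 = 1 / (2 * L)" using L by (simp add: c_def)
  then have c4: "c ^ 4 = 1 / (4 * L\<^sup>2)"
    using power_mult[of c 2 2] by (simp add: power_divide power2_eq_square)
  define f where "f = (\<lambda>x. \<Sum>k\<in>{1, - 1}. of_real c * fourier_mode L k x)"
  have f: "f x = of_real c * fourier_mode L 1 x + of_real c * fourier_mode L (- 1) x" for x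
    by (simp add: f_def)
  have cmod_f: "complex_of_real (cmod (f x) ^ (2 * n)) = f x ^ (2 * n)" for n x
  proof -
    have "cnj (f x) = f x"
      by (simp add: f cnj_fourier_mode)
    then show ?thesis
      using complex_norm_square[of "f x"] by (simp add: power_mult power2_eq_square)
  qed
  have int_f: "(LINT x:{0..L}|lebesgue. complex_of_real (cmod (f x) ^ (2 * n)))
      = of_real (L * c ^ (2 * n) * of_nat ((2 * n) choose n))" for n
    unfolding cmod_f unfolding f LINT_cosine_power[OF L] by simp
  have "complex_of_real (LINT x:{0..L}|lebesgue. (cmod (f x))\<^sup>2) = 1"
    using int_f[of 1] c2 L unfolding set_integral_complex_of_real by simp
  then have norm_f: "L2_norm_torus L f = 1"
    by (simp add: L2_norm_torus_def)
  have f_L2: "f \<in> L2_torus L"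
    unfolding f_def by (rule trig_poly_in_L2_torus[OF L])
  have "strichartz_form L f f f f = (LINT x:{0..L}|lebesgue. complex_of_real (cmod (f x) ^ 4))"
    unfolding f_def by (rule strichartz_form_eigenfunction[OF L, where m = 1]) auto
  also have "\<dots> = of_real (3 / (2 * L))"
  proof -
    have "(4::nat) choose 2 = 6" by (simp add: numeral_eq_Suc)
    then have "L * c ^ 4 * of_nat (4 choose 2) = 3 / (2 * L)"
      using L by (simp add: c4 power2_eq_square field_simps)
    then show ?thesis using int_f[of 2] by simp
  qed
  finally have form_f: "strichartz_form L f f f f = of_real (3 / (2 * L))" .

  \<comment> \<open>Written as a polynomial with the single frequency 0, the constant is an
    eigenfunction with \<open>m = 0\<close>, and the same formula for the form applies.\<close>
  have z: "z_const L = (\<lambda>x. \<Sum>k\<in>{0}. of_real (L powr (- 1 / 2)) * fourier_mode L k x)"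
    by (simp add: z_const_def)
  have z4: "cmod (z_const L x) ^ 4 = 1 / L\<^sup>2" for x
  proof -
    have "cmod (z_const L x) = L powr (- 1 / 2)"
      by (simp only: z_const_def norm_of_real abs_of_nonneg powr_ge_zero)
    then have "cmod (z_const L x) ^ 4 = L powr (- 2)"
      using L by (simp add: powr_power)
    then show ?thesis
      using L by (simp add: powr_minus inverse_eq_divide)
  qed
  have "strichartz_form L (z_const L) (z_const L) (z_const L) (z_const L)
      = (LINT x:{0..L}|lebesgue. complex_of_real (cmod (z_const L x) ^ 4))"
    unfolding z by (rule strichartz_form_eigenfunction[OF L, where m = 0]) auto
  also have "\<dots> = of_real (1 / L)"
    unfolding z4 using L
    by (simp add: set_lebesgue_integral_def scaleR_conv_of_real power2_eq_square)
  finally have form_z: "strichartz_form L (z_const L) (z_const L) (z_const L) (z_const L)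
      = of_real (1 / L)" .
  have "Re (strichartz_form L (z_const L) (z_const L) (z_const L) (z_const L))
      < Re (strichartz_form L f f f f)"
    unfolding form_f form_z Re_complex_of_real using L by (simp add: field_simps)
  then show "\<not> is_omega1_maximizer L (z_const L)"
    using f_L2 norm_f unfolding is_omega1_maximizer_def is_arg_max_def by blast
qed simp

end
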